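(* Let $\alpha,\beta,\gamma\in\mathbb{R}$ with $|\alpha|<1$, $|\beta|<1$ and $\beta\neq 0$, and let $(X_t,Y_t)_{t\in\mathbb{Z}}$ be the stationary bivariate linear autoregressive process whose structural equations, in time-averaged form, are $$X_f=X_{\alpha Sf}+E^X_f,\qquad Y_g=X_{\gamma Sg}+Y_{\beta Sg}+E^Y_g\qquad\text{for all } f,g\in\ell^1(\mathbb{Z}),$$ where $(E^X_t)_{t\in\mathbb{Z}}$, $(E^Y_t)_{t\in\mathbb{Z}}$ are i.i.d. $\mathcal{N}(0,1)$ noise variables. For a frequency $\nu\in\mathbb{R}$ and $T\in\mathbb{N}$ let $z_\nu:=e^{2\pi i\nu}$, let $g_{\nu,T}(t):=\frac{1}{\sqrt{2T+1}}e^{2\pi i\nu t}$ for $t=-T,\dots,T$ and $g_{\nu,T}(t):=0$ otherwise, and let $f_{\nu,T}:=\gamma S(I-\beta S)^{-1}g_{\nu,T}$. Then $$\left\|f_{\nu,T}-\gamma z_\nu(1-\beta z_\nu)^{-1}g_{\nu,T}\right\|_1\le\frac{2}{\sqrt{2T+1}}\,\frac{|\gamma|}{|\beta|}\,\left|(1-\beta)^{-2}\right|,$$ that is, $f_{\nu,T}$ coincides with a complex multiple of $g_{\nu,T}$ up to an error that decays with $O(1/\sqrt{T})$. With $$E^X_{\nu,T}:=E^X_{(I-\alpha S)^{-1}f_{\nu,T}},\qquad E^Y_{\nu,T}:=E^Y_{(I-\beta S)^{-1}g_{\nu,T}},$$ this implies the approximate structural equations $$X_{g_{\nu,T}}=E^X_{\nu,T},\qquad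 Y_{g_{\nu,T}}\approx\gamma e^{2\pi i\nu}\left(1-\beta e^{2\pi i\nu}\right)^{-1}X_{g_{\nu,T}}+E^Y_{\nu,T},$$ where the error of the approximation in the second equation is a random variable whose $L^1$-norm is bounded by $$\frac{2}{\sqrt{2T+1}}\,\frac{|\gamma|}{|\beta|}\,\left|(1-\beta)^{-2}\right|\cdot\mathbb{E}[|X_t|].$$
   Context: $S$ is the shift operator $(Sh)(t):=h(t+1)$ on $\ell^1(\mathbb{Z})$, and $\|\cdot\|_1$ is the $\ell^1(\mathbb{Z})$ norm. For (real- or complex-valued) $h\in\ell^1(\mathbb{Z})$ write $X_h:=\sum_{t\in\mathbb{Z}}h(t)X_t$, $Y_h:=\sum_{t\in\mathbb{Z}}h(t)Y_t$, $E^X_h:=\sum_{t\in\mathbb{Z}}h(t)E^X_t$, $E^Y_h:=\sum_{t\in\mathbb{Z}}h(t)E^Y_t$; the series converge in $L^1$ of the underlying probability space. Pointwise, the structural equations say $X_t=\alpha X_{t-1}+E^X_t$ and $Y_t=\gamma X_{t-1}+\beta Y_{t-1}+E^Y_t$; thus $\gamma$ is the coefficient of the influence of $X$ on $Y$ and $\beta$ is the autoregressive coefficient of $Y$. The chain is assumed to go back forever, so that $(X_t,Y_t)$ has the stationary, jointly normal distribution and $\mathbb{E}[|X_t|]$ does not depend on $t$. For $|c|<1$, $(I-cS)^{-1}=\sum_{j\ge0}(cS)^j$ (Neumann series, convergent on $\ell^1(\mathbb{Z})$).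
   Formalization: In both bounds |(1-β)^{-2}| is corrected to (1-|β|)^{-2} (the printed one fails for β=-9/10, γ=1, ν=1/2, T=0); X_g=E^X_{ν,T}, false for γ=0, is replaced by X_g=E^X_{(I-αS)^{-1}g} and X_f=E^X_{(I-αS)^{-1}f}, with g=g_{ν,T}, f=f_{ν,T}. *)

theory Defs
  imports "HOL-Probability.Probability" "HOL-Library.Landau_Symbols"
begin

section \<open>The sequence space and the resolvent of the shift\<close>

definition ell1 :: "(int \<Rightarrow> complex) set" where
  "ell1 = {h. (\<lambda>t. norm (h t)) summable_on UNIV}"

definition ell1_norm :: "(int \<Rightarrow> complex) \<Rightarrow> real" where
  "ell1_norm h = (\<Sum>\<^sub>\<infinity>t. norm (h t))"

definition shift :: "(int \<Rightarrow> complex) \<Rightarrow> int \<Rightarrow> complex" where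
  "shift h = (\<lambda>t. h (t + 1))"

definition scale :: "complex \<Rightarrow> (int \<Rightarrow> complex) \<Rightarrow> int \<Rightarrow> complex" where
  "scale c h = (\<lambda>t. c * h t)"

definition id_minus_shift :: "complex \<Rightarrow> (int \<Rightarrow> complex) \<Rightarrow> int \<Rightarrow> complex" where
  "id_minus_shift c h = (\<lambda>t. h t - c * shift h t)"

text \<open>The operator $(I - cS)^{-1}$ on $\ell^1(\mathbb{Z})$. For $|c| < 1$ the operator $I - cS$ is
  a bijection of $\ell^1(\mathbb{Z})$ and the inverse is the Neumann series; see
  \<open>bij_id_minus_shift\<close> and \<open>resolvent_eq_neumann\<close> below.\<close>

definition resolvent :: "complex \<Rightarrow> (int \<Rightarrow> complex) \<Rightarrow> int \<Rightarrow> complex" where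
  "resolvent c = inv_into ell1 (id_minus_shift c)"

definition neumann :: "complex \<Rightarrow> (int \<Rightarrow> complex) \<Rightarrow> int \<Rightarrow> complex" where
  "neumann c g = (\<lambda>t. \<Sum>\<^sub>\<infinity>j. c ^ j * g (t + int j))"

lemma summable_translate:
  fixes u :: "int \<Rightarrow> real"
  shows "(\<lambda>t. u (t + k)) summable_on UNIV \<longleftrightarrow> u summable_on UNIV"
  by (rule summable_on_reindex_bij_betw)
     (rule bij_betw_byWitness[where f' = "\<lambda>t. t - k"]; simp)

lemma infsum_translate:
  fixes u :: "int \<Rightarrow> real"
  shows "(\<Sum>\<^sub>\<infinity>t. u (t + k)) = (\<Sum>\<^sub>\<infinity>t. u t)"
  by (rule infsum_reindex_bij_betw)
     (rule bij_betw_byWitness[where f' = "\<lambda>t. t - k"]; simp)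

lemma ell1_shift: "h \<in> ell1 \<Longrightarrow> shift h \<in> ell1"
  by (simp add: ell1_def shift_def summable_translate[of "\<lambda>t. norm (h t)"])

lemma ell1_scale: "h \<in> ell1 \<Longrightarrow> scale c h \<in> ell1"
  by (simp add: ell1_def scale_def norm_mult summable_on_cmult_right)

lemma ell1_diff:
  assumes "h \<in> ell1" "k \<in> ell1" shows "(\<lambda>t. h t - k t) \<in> ell1"
proof -
  have "(\<lambda>t. norm (h t) + norm (k t)) summable_on UNIV"
    using assms by (auto simp: ell1_def intro: summable_on_add)
  then show ?thesis unfolding ell1_def mem_Collect_eq
    by (rule summable_on_comparison_test) (auto intro: norm_triangle_ineq4)
qed

lemma ell1_id_minus_shift: "h \<in> ell1 \<Longrightarrow> id_minus_shift c h \<in> ell1"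
  unfolding id_minus_shift_def
  using ell1_diff[OF _ ell1_scale[OF ell1_shift]] by (simp add: scale_def)

lemma neumann_double_summable:
  assumes "g \<in> ell1" "norm c < 1"
  shows "(\<lambda>(j, t). norm (c ^ j * g (t + int j))) summable_on (UNIV :: nat set) \<times> (UNIV :: int set)"
proof -
  have g: "(\<lambda>t. norm (g t)) summable_on UNIV" using assms by (simp add: ell1_def)
  have s: "(\<lambda>t. norm (g (t + int j))) summable_on UNIV" for j
    using g by (simp add: summable_translate[of "\<lambda>t. norm (g t)"])
  have geo: "(\<lambda>j. norm c ^ j) summable_on (UNIV :: nat set)"
    using assms(2) by (intro norm_summable_imp_summable_on) (simp add: summable_geometric)
  have "(\<lambda>p. norm ((\<lambda>(j, t). c ^ j * g (t + int j)) p)) summable_on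
      (SIGMA j:(UNIV::nat set). (UNIV::int set))"
    unfolding Infinite_Sum.abs_summable_on_Sigma_iff
  proof (intro conjI ballI)
    show "(\<lambda>t. norm ((\<lambda>(j, t). c ^ j * g (t + int j)) (j, t))) summable_on UNIV" for j
      using s by (simp add: norm_mult summable_on_cmult_right)
    have "(\<Sum>\<^sub>\<infinity>t. norm (c ^ j * g (t + int j))) = norm c ^ j * ell1_norm g" for j
      using infsum_translate[of "\<lambda>t. norm (g t)" "int j"]
      by (simp add: norm_mult norm_power infsum_cmult_right' ell1_norm_def)
    moreover have "0 \<le> ell1_norm g" by (simp add: ell1_norm_def infsum_nonneg)
    ultimately show "(\<lambda>j. norm (\<Sum>\<^sub>\<infinity>t. norm ((\<lambda>(j, t). c ^ j * g (t + int j)) (j, t)))) summable_on UNIV"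
      using geo by (simp add: summable_on_cmult_left)
  qed
  then show ?thesis by (simp add: case_prod_unfold)
qed

lemma neumann_summable:
  assumes "g \<in> ell1" "norm c < 1"
  shows "(\<lambda>j. norm (c ^ j * g (t + int j))) summable_on UNIV"
proof -
  have "(\<lambda>(t, j). norm (c ^ j * g (t + int j))) summable_on (UNIV :: int set) \<times> (UNIV :: nat set)"
    using neumann_double_summable[OF assms] by (subst summable_on_swap) (simp add: case_prod_unfold)
  from summable_on_SigmaD1[OF this, of t] show ?thesis by simp
qed

lemma neumann_ell1:
  assumes "g \<in> ell1" "norm c < 1"
  shows "neumann c g \<in> ell1"
proof -
  have "(\<lambda>p. norm ((\<lambda>(t, j). c ^ j * g (t + int j)) p)) summable_on
      (SIGMA t:(UNIV::int set). (UNIV::nat set))"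
    using neumann_double_summable[OF assms]
    by (subst summable_on_swap) (simp add: case_prod_unfold)
  then have "(\<lambda>t. norm (\<Sum>\<^sub>\<infinity>j. norm (c ^ j * g (t + int j)))) summable_on UNIV"
    unfolding Infinite_Sum.abs_summable_on_Sigma_iff by simp
  then show ?thesis unfolding ell1_def mem_Collect_eq neumann_def
    by (rule summable_on_comparison_test)
       (auto simp: abs_of_nonneg infsum_nonneg intro!: norm_infsum_bound neumann_summable[OF assms])
qed

lemma id_minus_shift_neumann:
  assumes "g \<in> ell1" "norm c < 1"
  shows "id_minus_shift c (neumann c g) = g"
proof
  fix t
  let ?u = "\<lambda>j. c ^ j * g (t + int j)"
  have s: "?u summable_on UNIV"
    by (rule Infinite_Sum.abs_summable_summable) (rule neumann_summable[OF assms])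
  have s1: "?u summable_on (range Suc)" by (rule summable_on_subset_banach[OF s]) simp
  have "(\<Sum>\<^sub>\<infinity>j. ?u j) = (\<Sum>\<^sub>\<infinity>j\<in>{0} \<union> range Suc. ?u j)"
    by (simp add: UNIV_nat_eq[symmetric])
  also have "\<dots> = ?u 0 + (\<Sum>\<^sub>\<infinity>j\<in>range Suc. ?u j)"
    by (subst infsum_Un_disjoint) (auto simp: s1)
  also have "(\<Sum>\<^sub>\<infinity>j\<in>range Suc. ?u j) = (\<Sum>\<^sub>\<infinity>j. c * (c ^ j * g (t + 1 + int j)))"
    by (subst infsum_reindex) (auto simp: o_def algebra_simps)
  also have "\<dots> = c * (\<Sum>\<^sub>\<infinity>j. c ^ j * g (t + 1 + int j))"
    by (simp add: infsum_cmult_right')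
  finally show "id_minus_shift c (neumann c g) t = g t"
    by (simp add: id_minus_shift_def shift_def neumann_def)
qed

lemma inj_on_id_minus_shift:
  assumes c: "norm c < 1"
  shows "inj_on (id_minus_shift c) ell1"
proof (rule inj_onI)
  fix h k assume hk: "h \<in> ell1" "k \<in> ell1" and eq: "id_minus_shift c h = id_minus_shift c k"
  define d where "d = (\<lambda>t. h t - k t)"
  have d: "(\<lambda>t. norm (d t)) summable_on UNIV"
    using ell1_diff[OF hk] by (simp add: d_def ell1_def)
  have "d t = c * d (t + 1)" for t
    using fun_cong[OF eq, of t] by (simp add: d_def id_minus_shift_def shift_def algebra_simps)
  then have "(\<Sum>\<^sub>\<infinity>t. norm (d t)) = (\<Sum>\<^sub>\<infinity>t. norm c * norm (d (t + 1)))"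
    by (metis norm_mult)
  also have "\<dots> = norm c * (\<Sum>\<^sub>\<infinity>t. norm (d t))"
    using infsum_translate[of "\<lambda>t. norm (d t)" 1] by (simp add: infsum_cmult_right')
  finally have "(\<Sum>\<^sub>\<infinity>t. norm (d t)) = 0" using c by simp
  then have "norm (d t) = 0" for t
    using nonneg_infsum_le_0D[OF _ d, of t] by simp
  then show "h = k" by (auto simp: d_def)
qed

lemma bij_id_minus_shift:
  assumes "norm c < 1"
  shows "bij_betw (id_minus_shift c) ell1 ell1"
proof (rule bij_betw_imageI[OF inj_on_id_minus_shift[OF assms]])
  show "id_minus_shift c ` ell1 = ell1"
  proof
    show "id_minus_shift c ` ell1 \<subseteq> ell1" by (auto intro: ell1_id_minus_shift)
    show "ell1 \<subseteq> id_minus_shift c ` ell1"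
    proof
      fix g assume g: "g \<in> ell1"
      show "g \<in> id_minus_shift c ` ell1"
        using id_minus_shift_neumann[OF g assms] neumann_ell1[OF g assms] by (metis imageI)
    qed
  qed
qed

lemma resolvent_eq_neumann:
  assumes "g \<in> ell1" "norm c < 1"
  shows "resolvent c g = neumann c g"
  unfolding resolvent_def
  by (rule inv_into_f_eq[OF inj_on_id_minus_shift]) (use assms in \<open>auto intro: neumann_ell1 id_minus_shift_neumann\<close>)


section \<open>Time averages of a process\<close>

text \<open>The random variable $X_h = \sum_t h(t) X_t$, as a pointwise sum. If the $X_t$ are bounded in
  $L^1$, it converges absolutely almost surely and in $L^1$; see \<open>time_avg_L1\<close>.\<close>

definition time_avg :: "(int \<Rightarrow> 'w \<Rightarrow> real) \<Rightarrow> (int \<Rightarrow> complex) \<Rightarrow> 'w \<Rightarrow> complex" where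
  "time_avg X h \<omega> = (\<Sum>\<^sub>\<infinity>t. h t * complex_of_real (X t \<omega>))"

lemma time_avg_bound:
  fixes M :: "'w measure"
  assumes M: "sigma_finite_measure M" and X: "\<And>t. integrable M (X t)" and K: "\<And>t. (\<integral>\<omega>. \<bar>X t \<omega>\<bar> \<partial>M) \<le> K"
    and h: "h \<in> ell1"
  shows "AE \<omega> in M. (\<lambda>t. norm (h t * complex_of_real (X t \<omega>))) summable_on UNIV"
    and "integrable M (time_avg X h)"
    and "(\<integral>\<omega>. norm (time_avg X h \<omega>) \<partial>M) \<le> K * ell1_norm h"
proof -
  let ?C = "count_space (UNIV :: int set)"
  let ?f = "\<lambda>t \<omega>. h t * complex_of_real (X t \<omega>)"
  interpret C: sigma_finite_measure ?C by (rule sigma_finite_measure_count_space_countable) simp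
  interpret M: sigma_finite_measure M by fact
  interpret P: pair_sigma_finite ?C M ..
  have Xm [measurable]: "X t \<in> borel_measurable M" for t using X by blast
  have meas [measurable]: "(\<lambda>(t, \<omega>). ?f t \<omega>) \<in> borel_measurable (?C \<Otimes>\<^sub>M M)"
    by (rule measurable_pair_measure_countable1) auto
  have n: "(\<integral>\<omega>. norm (?f t \<omega>) \<partial>M) = norm (h t) * (\<integral>\<omega>. \<bar>X t \<omega>\<bar> \<partial>M)" for t
    by (simp add: norm_mult)
  have hs: "(\<lambda>t. norm (h t)) summable_on UNIV" using h by (simp add: ell1_def)
  have hsK: "(\<lambda>t. K * norm (h t)) summable_on UNIV" by (rule summable_on_cmult_right[OF hs])
  have le: "norm (h t) * (\<integral>\<omega>. \<bar>X t \<omega>\<bar> \<partial>M) \<le> K * norm (h t)" for t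
    using mult_right_mono[OF K[of t], of "norm (h t)"] by (simp add: mult.commute)
  have s: "(\<lambda>t. norm (h t) * (\<integral>\<omega>. \<bar>X t \<omega>\<bar> \<partial>M)) summable_on UNIV"
    by (rule summable_on_comparison_test[OF hsK]) (use le in auto)
  have i: "integrable (?C \<Otimes>\<^sub>M M) (\<lambda>(t, \<omega>). ?f t \<omega>)"
  proof (rule P.Fubini_integrable[OF meas])
    have "(\<lambda>t. norm (norm (h t) * (\<integral>\<omega>. \<bar>X t \<omega>\<bar> \<partial>M))) summable_on UNIV" using s by simp
    then show "integrable ?C (\<lambda>t. \<integral>\<omega>. norm (case (t, \<omega>) of (t, \<omega>) \<Rightarrow> ?f t \<omega>) \<partial>M)"
      unfolding abs_summable_equivalent Infinite_Set_Sum.abs_summable_on_def by (simp add: n)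
    show "AE t in ?C. integrable M (\<lambda>\<omega>. case (t, \<omega>) of (t, \<omega>) \<Rightarrow> ?f t \<omega>)"
      using X by (auto intro!: AE_I2 integrable_mult_right)
  qed
  have ae: "AE \<omega> in M. Infinite_Set_Sum.abs_summable_on (\<lambda>t. ?f t \<omega>) UNIV"
    using P.AE_integrable_snd[OF i] by (simp add: Infinite_Set_Sum.abs_summable_on_def)
  then show ae': "AE \<omega> in M. (\<lambda>t. norm (?f t \<omega>)) summable_on UNIV"
    by (simp add: abs_summable_equivalent)
  have eqn: "time_avg X h \<omega> = (\<integral>t. ?f t \<omega> \<partial>?C)" for \<omega>
  proof (cases "integrable ?C (\<lambda>t. ?f t \<omega>)")
    case True
    then have "Infinite_Set_Sum.abs_summable_on (\<lambda>t. ?f t \<omega>) UNIV"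
      by (simp add: Infinite_Set_Sum.abs_summable_on_def)
    then show ?thesis by (simp add: time_avg_def infsetsum_infsum[symmetric] infsetsum_def)
  next
    case False
    then have "\<not> (\<lambda>t. ?f t \<omega>) summable_on UNIV"
      unfolding summable_on_iff_abs_summable_on_complex abs_summable_equivalent
      by (simp add: Infinite_Set_Sum.abs_summable_on_def)
    then show ?thesis using False
      by (simp add: time_avg_def infsum_not_exists not_integrable_integral_eq)
  qed
  show "integrable M (time_avg X h)"
    unfolding eqn[abs_def] using P.integrable_snd[OF i] .
  have "(\<integral>\<omega>. norm (time_avg X h \<omega>) \<partial>M) \<le> (\<integral>\<omega>. (\<integral>t. norm (?f t \<omega>) \<partial>?C) \<partial>M)"
  proof (rule integral_mono)
    show "integrable M (\<lambda>\<omega>. norm (time_avg X h \<omega>))"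
      unfolding eqn[abs_def] using P.integrable_snd[OF i] by (rule integrable_norm)
    show "integrable M (\<lambda>\<omega>. \<integral>t. norm (?f t \<omega>) \<partial>?C)"
      by (rule P.integrable_snd) (use integrable_norm[OF i] in \<open>simp add: case_prod_unfold\<close>)
    show "norm (time_avg X h \<omega>) \<le> (\<integral>t. norm (?f t \<omega>) \<partial>?C)" for \<omega>
      unfolding eqn by (rule integral_norm_bound)
  qed
  also have "\<dots> = (\<integral>t. (\<integral>\<omega>. norm (?f t \<omega>) \<partial>M) \<partial>?C)"
    by (rule P.Fubini_integral) (use integrable_norm[OF i] in \<open>simp add: case_prod_unfold\<close>)
  also have "\<dots> = (\<Sum>\<^sub>\<infinity>t. norm (h t) * (\<integral>\<omega>. \<bar>X t \<omega>\<bar> \<partial>M))"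
  proof -
    have "Infinite_Set_Sum.abs_summable_on (\<lambda>t. norm (h t) * (\<integral>\<omega>. \<bar>X t \<omega>\<bar> \<partial>M)) UNIV"
      unfolding abs_summable_equivalent[symmetric] using s by simp
    from infsetsum_infsum[OF this] show ?thesis unfolding n infsetsum_def .
  qed
  also have "\<dots> \<le> (\<Sum>\<^sub>\<infinity>t. K * norm (h t))"
    by (rule infsum_mono[OF s hsK le])
  also have "\<dots> = K * ell1_norm h" by (simp add: infsum_cmult_right' ell1_norm_def)
  finally show "(\<integral>\<omega>. norm (time_avg X h \<omega>) \<partial>M) \<le> K * ell1_norm h" .
qed

lemma time_avg_L1:
  fixes M :: "'w measure"
  assumes M: "sigma_finite_measure M" and X: "\<And>t. integrable M (X t)" and K: "\<And>t. (\<integral>\<omega>. \<bar>X t \<omega>\<bar> \<partial>M) \<le> K"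
    and h: "h \<in> ell1"
  shows "((\<lambda>F. \<integral>\<omega>. norm ((\<Sum>t\<in>F. h t * complex_of_real (X t \<omega>)) - time_avg X h \<omega>) \<partial>M) \<longlongrightarrow> 0)
           (finite_subsets_at_top UNIV)"
proof (rule tendsto_sandwich[OF _ _ tendsto_const])
  let ?r = "\<lambda>F t. if t \<in> F then 0 else h t"
  have hs: "(\<lambda>t. norm (h t)) summable_on UNIV" using h by (simp add: ell1_def)
  have r: "?r F \<in> ell1" for F
    unfolding ell1_def mem_Collect_eq by (rule summable_on_comparison_test[OF hs]) auto
  have rn: "ell1_norm (?r F) = ell1_norm h - (\<Sum>t\<in>F. norm (h t))" if "finite F" for F
  proof -
    have "ell1_norm (?r F) = (\<Sum>\<^sub>\<infinity>t\<in>UNIV - F. norm (h t))"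
      unfolding ell1_norm_def by (rule infsum_cong_neutral) auto
    also have "\<dots> = ell1_norm h - (\<Sum>\<^sub>\<infinity>t\<in>F. norm (h t))"
      unfolding ell1_norm_def by (rule infsum_Diff[OF hs]) (use that in auto)
    finally show ?thesis using that by simp
  qed
  show "\<forall>\<^sub>F F in finite_subsets_at_top UNIV.
      0 \<le> (\<integral>\<omega>. norm ((\<Sum>t\<in>F. h t * complex_of_real (X t \<omega>)) - time_avg X h \<omega>) \<partial>M)"
    by (intro always_eventually allI integral_nonneg) auto
  show "\<forall>\<^sub>F F in finite_subsets_at_top UNIV.
      (\<integral>\<omega>. norm ((\<Sum>t\<in>F. h t * complex_of_real (X t \<omega>)) - time_avg X h \<omega>) \<partial>M)
        \<le> K * (ell1_norm h - (\<Sum>t\<in>F. norm (h t)))"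
  proof (rule eventually_mono[OF eventually_finite_subsets_at_top_weakI[of "UNIV :: int set" finite]])
    fix F :: "int set" assume F: "finite F"
    note B = time_avg_bound[OF M X K]
    have [measurable]: "X t \<in> borel_measurable M" for t using X by blast
    have [measurable]: "time_avg X h \<in> borel_measurable M" "time_avg X (?r F) \<in> borel_measurable M"
      using B(2)[OF h] B(2)[OF r[of F]] by auto
    have "AE \<omega> in M. (\<Sum>t\<in>F. h t * complex_of_real (X t \<omega>)) - time_avg X h \<omega> = - time_avg X (?r F) \<omega>"
      using B(1)[OF h]
    proof eventually_elim
      fix \<omega> assume elim: "(\<lambda>t. norm (h t * complex_of_real (X t \<omega>))) summable_on UNIV"
      let ?u = "\<lambda>t. h t * complex_of_real (X t \<omega>)"
      have "time_avg X (?r F) \<omega> = (\<Sum>\<^sub>\<infinity>t\<in>UNIV - F. ?u t)"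
        unfolding time_avg_def by (rule infsum_cong_neutral) auto
      also have "\<dots> = time_avg X h \<omega> - (\<Sum>\<^sub>\<infinity>t\<in>F. ?u t)"
        unfolding time_avg_def
        by (rule infsum_Diff[OF Infinite_Sum.abs_summable_summable[OF elim]]) (use F in auto)
      finally show "(\<Sum>t\<in>F. ?u t) - time_avg X h \<omega> = - time_avg X (?r F) \<omega>" using F by simp
    qed
    then have "(\<integral>\<omega>. norm ((\<Sum>t\<in>F. h t * complex_of_real (X t \<omega>)) - time_avg X h \<omega>) \<partial>M)
        = (\<integral>\<omega>. norm (time_avg X (?r F) \<omega>) \<partial>M)"
      by (intro integral_cong_AE) auto
    also have "\<dots> \<le> K * ell1_norm (?r F)" by (rule B(3)[OF r])
    finally show "(\<integral>\<omega>. norm ((\<Sum>t\<in>F. h t * complex_of_real (X t \<omega>)) - time_avg X h \<omega>) \<partial>M)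
        \<le> K * (ell1_norm h - (\<Sum>t\<in>F. norm (h t)))"
      unfolding rn[OF F] .
  qed
  have "((\<lambda>F. K * (ell1_norm h - (\<Sum>t\<in>F. norm (h t)))) \<longlongrightarrow> K * (ell1_norm h - ell1_norm h))
      (finite_subsets_at_top UNIV)"
    unfolding ell1_norm_def by (intro tendsto_intros infsum_tendsto hs)
  then show "((\<lambda>F. K * (ell1_norm h - (\<Sum>t\<in>F. norm (h t)))) \<longlongrightarrow> 0) (finite_subsets_at_top UNIV)"
    by simp
qed


section \<open>The stationary bivariate autoregressive process\<close>

text \<open>Degenerate (almost surely constant) normal laws are allowed, as usual in the definition of
  joint normality by linear combinations.\<close>

definition normal_rv :: "'w measure \<Rightarrow> ('w \<Rightarrow> real) \<Rightarrow> bool" where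
  "normal_rv M Z \<longleftrightarrow> (\<exists>\<mu>. AE \<omega> in M. Z \<omega> = \<mu>) \<or> (\<exists>\<mu> \<sigma>. 0 < \<sigma> \<and> distributed M lborel Z (normal_density \<mu> \<sigma>))"

definition jointly_normal :: "'w measure \<Rightarrow> ('w \<Rightarrow> real) \<Rightarrow> ('w \<Rightarrow> real) \<Rightarrow> bool" where
  "jointly_normal M U V \<longleftrightarrow> (\<forall>a b. normal_rv M (\<lambda>\<omega>. a * U \<omega> + b * V \<omega>))"

text \<open>The two noise sequences together form one i.i.d. family, indexed by the sum type
  \<open>int + int\<close>.\<close>

locale stationary_AR = prob_space M
  for M :: "'w measure" +
  fixes \<alpha> \<beta> \<gamma> :: real and X Y E_X E_Y :: "int \<Rightarrow> 'w \<Rightarrow> real"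
  assumes X_rv: "\<And>t. random_variable borel (X t)"
    and Y_rv: "\<And>t. random_variable borel (Y t)"
    and noise_indep: "indep_vars (\<lambda>_. borel) (case_sum E_X E_Y) UNIV"
    and E_X_normal: "\<And>t. distributed M lborel (E_X t) std_normal_density"
    and E_Y_normal: "\<And>t. distributed M lborel (E_Y t) std_normal_density"
    and stationary: "\<And>s. distr M (\<Pi>\<^sub>M t\<in>UNIV. borel \<Otimes>\<^sub>M borel) (\<lambda>\<omega> t. (X (t + s) \<omega>, Y (t + s) \<omega>))
                       = distr M (\<Pi>\<^sub>M t\<in>UNIV. borel \<Otimes>\<^sub>M borel) (\<lambda>\<omega> t. (X t \<omega>, Y t \<omega>))"
    and normal: "\<And>t. jointly_normal M (X t) (Y t)"
    and structural_X: "\<And>f. f \<in> ell1 \<Longrightarrow>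
      AE \<omega> in M. time_avg X f \<omega> = time_avg X (scale \<alpha> (shift f)) \<omega> + time_avg E_X f \<omega>"
    and structural_Y: "\<And>g. g \<in> ell1 \<Longrightarrow>
      AE \<omega> in M. time_avg Y g \<omega>
        = time_avg X (scale \<gamma> (shift g)) \<omega> + time_avg Y (scale \<beta> (shift g)) \<omega> + time_avg E_Y g \<omega>"


section \<open>Frequency-localised test functions\<close>

definition z_freq :: "real \<Rightarrow> complex" where
  "z_freq \<nu> = exp (2 * pi * \<i> * \<nu>)"

definition g_freq :: "real \<Rightarrow> nat \<Rightarrow> int \<Rightarrow> complex" where
  "g_freq \<nu> T t = (if - int T \<le> t \<and> t \<le> int T
     then 1 / sqrt (2 * real T + 1) * exp (2 * pi * \<i> * \<nu> * of_int t) else 0)"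

definition f_freq :: "real \<Rightarrow> real \<Rightarrow> real \<Rightarrow> nat \<Rightarrow> int \<Rightarrow> complex" where
  "f_freq \<beta> \<gamma> \<nu> T = scale \<gamma> (shift (resolvent \<beta> (g_freq \<nu> T)))"

end

(*
  Write g for the test function, z for its frequency and r = S g - z g. Since S and (I - beta S)^(-1)
  commute,
    (I - beta S) (f - gamma z (1 - beta z)^(-1) g) = gamma (1 - beta z)^(-1) r,
  and r vanishes except at the two ends of the window. As ||(I - beta S) d|| >= (1 - |beta|) ||d||
  and |1 - beta z| >= 1 - |beta|, this bounds the l1 distance. Inserting (I - alpha S)^(-1) g and
  (I - beta S)^(-1) g into the structural equations gives X_g = E^X_{(I - alpha S)^(-1) g} and
  Y_g = X_f + E^Y_{(I - beta S)^(-1) g}, so the error of the second approximate equation is the time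
  average of X against f - gamma z (1 - beta z)^(-1) g.
*)

theory Submission
  imports Defs
begin

section \<open>Resolvents and norm estimates on the sequence space\<close>

lemma resolvent_ell1: "g \<in> ell1 \<Longrightarrow> norm c < 1 \<Longrightarrow> resolvent c g \<in> ell1"
  by (simp add: resolvent_eq_neumann neumann_ell1)

lemma id_minus_shift_resolvent:
  "g \<in> ell1 \<Longrightarrow> norm c < 1 \<Longrightarrow> id_minus_shift c (resolvent c g) = g"
  by (simp add: resolvent_eq_neumann id_minus_shift_neumann)

text \<open>A divergent \<open>infsum\<close> has the value 0, so for \<open>k\<close> outside
  \<open>ell1\<close> the inequality can fail.\<close>

lemma ell1_norm_triangle_diff:
  assumes "h \<in> ell1" "k \<in> ell1"
  shows "ell1_norm h - ell1_norm k \<le> ell1_norm (\<lambda>t. h t - k t)"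
proof -
  have le: "norm (h t) \<le> norm (h t - k t) + norm (k t)" for t
    using norm_triangle_ineq[of "h t - k t" "k t"] by simp
  have d: "(\<lambda>t. norm (h t - k t)) summable_on UNIV" and k: "(\<lambda>t. norm (k t)) summable_on UNIV"
    using assms ell1_diff[OF assms] by (simp_all add: ell1_def)
  have "ell1_norm h \<le> (\<Sum>\<^sub>\<infinity>t. norm (h t - k t) + norm (k t))"
    unfolding ell1_norm_def
    by (rule infsum_mono)
       (use assms d k in \<open>auto simp: ell1_def intro!: summable_on_add le\<close>)
  also have "\<dots> = ell1_norm (\<lambda>t. h t - k t) + ell1_norm k"
    unfolding ell1_norm_def by (rule infsum_add[OF d k])
  finally show ?thesis by simp
qed

lemma ell1_norm_shift: "ell1_norm (shift h) = ell1_norm h"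
  using infsum_translate[of "\<lambda>t. norm (h t)" 1] by (simp add: ell1_norm_def shift_def)

lemma ell1_norm_scale: "ell1_norm (scale c h) = norm c * ell1_norm h"
  by (simp add: ell1_norm_def scale_def norm_mult infsum_cmult_right')

text \<open>The shift is an isometry, so the reverse triangle inequality applies. For
  \<open>norm c < 1\<close> this bounds the inverse of \<open>id_minus_shift c\<close> by
  \<open>1 / (1 - norm c)\<close> without summing the Neumann series.\<close>

lemma ell1_norm_id_minus_shift_ge:
  assumes "h \<in> ell1"
  shows "(1 - norm c) * ell1_norm h \<le> ell1_norm (id_minus_shift c h)"
  using ell1_norm_triangle_diff[OF assms ell1_scale[OF ell1_shift[OF assms]], of c]
  by (simp only: ell1_norm_scale ell1_norm_shift)
     (simp add: id_minus_shift_def scale_def left_diff_distrib)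

section \<open>Frequency-localised test functions and their images\<close>

lemma g_freq_ell1: "g_freq \<nu> T \<in> ell1"
proof -
  have "(\<lambda>t. norm (g_freq \<nu> T t)) summable_on {- int T..int T}"
    by (rule summable_on_finite) simp
  then show ?thesis unfolding ell1_def mem_Collect_eq
    by (rule summable_on_cong_neutral[THEN iffD1, rotated -1]) (auto simp: g_freq_def)
qed

lemma norm_z_freq: "norm (z_freq \<nu>) = 1"
  by (simp add: z_freq_def)

text \<open>The two sequences agree in the interior of the window and differ only at its two ends.\<close>

lemma ell1_norm_shift_g_freq:
  "ell1_norm (\<lambda>t. shift (g_freq \<nu> T) t - z_freq \<nu> * g_freq \<nu> T t) \<le> 2 / sqrt (2 * real T + 1)"
proof -
  let ?r = "\<lambda>t. shift (g_freq \<nu> T) t - z_freq \<nu> * g_freq \<nu> T t"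
  have g: "norm (g_freq \<nu> T t) \<le> 1 / sqrt (2 * real T + 1)" for t
    by (simp add: g_freq_def norm_mult norm_divide)
  \<comment> \<open>The untruncated exponential is an eigenvector of the shift with eigenvalue
    \<open>z_freq \<nu>\<close>; only the truncation spoils this.\<close>
  have z: "exp (2 * pi * \<i> * \<nu> * of_int (t + 1)) = z_freq \<nu> * exp (2 * pi * \<i> * \<nu> * of_int t)" for t
    by (simp add: z_freq_def exp_add[symmetric] algebra_simps)
  \<comment> \<open>\<open>shift\<close> reads position t + 1: the left mismatch sits at
    \<open>- int T - 1\<close>, where t + 1 enters the window, the right one at
    \<open>int T\<close>, where t + 1 leaves it.\<close>
  have 0: "?r t = 0" if "t \<notin> {- int T - 1, int T}" for t
    using that z[of t] by (auto simp: shift_def g_freq_def)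
  have "ell1_norm ?r = (\<Sum>\<^sub>\<infinity>t\<in>{- int T - 1, int T}. norm (?r t))"
    unfolding ell1_norm_def by (rule infsum_cong_neutral) (use 0 in auto)
  also have "\<dots> = norm (?r (- int T - 1)) + norm (?r (int T))"
    by simp
  also have "norm (?r (- int T - 1)) = norm (g_freq \<nu> T (- int T))"
    by (simp add: shift_def g_freq_def)
  also have "norm (?r (int T)) = norm (g_freq \<nu> T (int T))"
    by (simp add: shift_def g_freq_def norm_mult norm_divide norm_z_freq)
  also have "norm (g_freq \<nu> T (- int T)) + norm (g_freq \<nu> T (int T)) \<le> 2 / sqrt (2 * real T + 1)"
    using g[of "- int T"] g[of "int T"] by simp
  finally show ?thesis .
qed

lemma f_freq_ell1: "\<bar>\<beta>\<bar> < 1 \<Longrightarrow> f_freq \<beta> \<gamma> \<nu> T \<in> ell1"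
  unfolding f_freq_def by (intro ell1_scale ell1_shift resolvent_ell1 g_freq_ell1) simp

lemma f_freq_approx:
  fixes \<beta> \<gamma> \<nu> :: real
  defines "c \<equiv> \<gamma> * z_freq \<nu> * inverse (1 - \<beta> * z_freq \<nu>)"
  assumes b: "\<bar>\<beta>\<bar> < 1"
  shows "(\<lambda>t. f_freq \<beta> \<gamma> \<nu> T t - c * g_freq \<nu> T t) \<in> ell1"
    and "ell1_norm (\<lambda>t. f_freq \<beta> \<gamma> \<nu> T t - c * g_freq \<nu> T t)
      \<le> 2 / sqrt (2 * real T + 1) * \<bar>\<gamma>\<bar> * inverse ((1 - \<bar>\<beta>\<bar>)\<^sup>2)"
proof -
  let ?g = "g_freq \<nu> T" and ?z = "z_freq \<nu>"
  let ?d = "\<lambda>t. f_freq \<beta> \<gamma> \<nu> T t - c * ?g t"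
  let ?r = "\<lambda>t. shift ?g t - ?z * ?g t"
  let ?h = "resolvent \<beta> ?g"
  let ?q = "1 - \<beta> * ?z"
  show d: "?d \<in> ell1"
    using ell1_diff[OF f_freq_ell1[OF b] ell1_scale[OF g_freq_ell1], of \<gamma> \<nu> T c]
    by (simp add: scale_def)
  have q: "1 - \<bar>\<beta>\<bar> \<le> norm ?q"
    using norm_triangle_ineq2[of 1 "\<beta> * ?z"] by (simp add: norm_mult norm_z_freq)
  then have q0: "?q \<noteq> 0" using b by force
  have "id_minus_shift \<beta> ?h = ?g"
    using id_minus_shift_resolvent[OF g_freq_ell1] b by simp
  then have h: "?h t = ?g t + \<beta> * ?h (t + 1)" for t
    by (metis (no_types) id_minus_shift_def shift_def diff_add_cancel)
  have "id_minus_shift \<beta> ?d t = (\<gamma> / ?q) * ?r t" for t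
  proof -
    have "id_minus_shift \<beta> ?d t = \<gamma> * (?h (t + 1) - \<beta> * ?h (t + 1 + 1)) - c * (?g t - \<beta> * ?g (t + 1))"
      by (simp add: id_minus_shift_def shift_def f_freq_def scale_def algebra_simps)
    also have "?h (t + 1) - \<beta> * ?h (t + 1 + 1) = ?g (t + 1)"
      by (subst h[of "t + 1"]) simp
    \<comment> \<open>Writing \<gamma> as \<open>\<gamma> / ?q * (1 - \<beta> * ?z)\<close> makes
      the two terms with \<open>\<beta> * ?z * ?g (t + 1)\<close> cancel, which leaves
      \<open>?r t\<close>.\<close>
    finally show ?thesis
      using q0 by (simp add: c_def shift_def divide_simps) (simp add: algebra_simps)
  qed
  then have "id_minus_shift \<beta> ?d = scale (\<gamma> / ?q) ?r"
    unfolding scale_def by blast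
  then have "ell1_norm ?d * (1 - \<bar>\<beta>\<bar>) \<le> \<bar>\<gamma>\<bar> / norm ?q * ell1_norm ?r"
    using ell1_norm_id_minus_shift_ge[OF d, of \<beta>] by (simp add: ell1_norm_scale norm_divide mult.commute)
  \<comment> \<open>The lower bound on \<open>norm ?q\<close> gives one factor
    \<open>1 / (1 - \<bar>\<beta>\<bar>)\<close>; dividing the left side by
    \<open>1 - \<bar>\<beta>\<bar>\<close> gives the other, hence the square.\<close>
  also have "\<dots> \<le> \<bar>\<gamma>\<bar> / (1 - \<bar>\<beta>\<bar>) * (2 / sqrt (2 * real T + 1))"
    using q b ell1_norm_shift_g_freq[of \<nu> T]
    by (intro mult_mono divide_left_mono mult_pos_pos) (auto simp: ell1_norm_def infsum_nonneg q0)
  finally have "ell1_norm ?d \<le> \<bar>\<gamma>\<bar> / (1 - \<bar>\<beta>\<bar>) * (2 / sqrt (2 * real T + 1)) / (1 - \<bar>\<beta>\<bar>)"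
    using b by (simp only: pos_le_divide_eq diff_gt_0_iff_gt)
  then show "ell1_norm ?d \<le> 2 / sqrt (2 * real T + 1) * \<bar>\<gamma>\<bar> * inverse ((1 - \<bar>\<beta>\<bar>)\<^sup>2)"
    by (simp add: power2_eq_square divide_inverse mult_ac)
qed

section \<open>Linearity of time averages and integrability of normal variables\<close>

lemma time_avg_diff:
  assumes "(\<lambda>t. norm (h t * complex_of_real (X t \<omega>))) summable_on UNIV"
    and "(\<lambda>t. norm (k t * complex_of_real (X t \<omega>))) summable_on UNIV"
  shows "time_avg X (\<lambda>t. h t - k t) \<omega> = time_avg X h \<omega> - time_avg X k \<omega>"
proof -
  have "((\<lambda>t. h t * complex_of_real (X t \<omega>)) has_sum time_avg X h \<omega>) UNIV"
    and "((\<lambda>t. k t * complex_of_real (X t \<omega>)) has_sum time_avg X k \<omega>) UNIV"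
    unfolding time_avg_def
    by (rule has_sum_infsum, rule Infinite_Sum.abs_summable_summable, rule assms)+
  then have "((\<lambda>t. h t * complex_of_real (X t \<omega>) + - (k t * complex_of_real (X t \<omega>)))
      has_sum (time_avg X h \<omega> + - time_avg X k \<omega>)) UNIV"
    by (rule has_sum_add[OF _ has_sum_uminusI])
  from infsumI[OF this] show ?thesis
    by (simp add: time_avg_def[of X "\<lambda>t. h t - k t"] left_diff_distrib)
qed

text \<open>Scaling by a nonzero \<open>c\<close> preserves divergence, so the default value 0 of a
  divergent series is harmless here, whereas the rule for differences assumes convergence at
  \<omega>.\<close>

lemma time_avg_scale: "time_avg X (scale c h) \<omega> = c * time_avg X h \<omega>"
  by (simp add: time_avg_def scale_def mult.assoc infsum_cmult_right')

context prob_space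
begin

text \<open>Uniformly bounded first absolute moments make both series converge absolutely off a null
  set, where the pointwise rule applies.\<close>

lemma AE_time_avg_diff:
  assumes X: "\<And>t. integrable M (X t)" and K: "\<And>t. (\<integral>\<omega>. \<bar>X t \<omega>\<bar> \<partial>M) \<le> K"
    and h: "h \<in> ell1" "k \<in> ell1"
  shows "AE \<omega> in M. time_avg X (\<lambda>t. h t - k t) \<omega> = time_avg X h \<omega> - time_avg X k \<omega>"
  using time_avg_bound(1)[OF sigma_finite_measure_axioms X K h(1)]
    time_avg_bound(1)[OF sigma_finite_measure_axioms X K h(2)]
  by eventually_elim (rule time_avg_diff)

lemma normal_distributed_integrable:
  assumes "distributed M lborel Z (normal_density \<mu> \<sigma>)" "0 < \<sigma>"
  shows "integrable M Z"
  using distributed_integrable_var[OF assms(1)] integrable_normal_moment_nz_1[OF assms(2)] by simp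

text \<open>In the degenerate case \<open>Z\<close> is only almost surely constant, and its
  measurability must be supplied; in the other case \<open>distributed\<close> contains it.\<close>

lemma normal_rv_integrable:
  assumes "normal_rv M Z" "random_variable borel Z"
  shows "integrable M Z"
  using assms(1) unfolding normal_rv_def
proof (elim disjE exE conjE)
  fix \<mu> assume "AE \<omega> in M. Z \<omega> = \<mu>"
  then show ?thesis
    using integrable_cong_AE[OF assms(2), of "\<lambda>_. \<mu>"] by simp
qed (rule normal_distributed_integrable)

end

section \<open>Moments of the process and solution of its structural equations\<close>

context stationary_AR
begin

lemma integrable_X: "integrable M (X t)"
  using normal_rv_integrable[OF _ X_rv, of t] normal[of t, unfolded jointly_normal_def, rule_format, of 1 0]
  by simp

lemma integrable_Y: "integrable M (Y t)"
  using normal_rv_integrable[OF _ Y_rv, of t] normal[of t, unfolded jointly_normal_def, rule_format, of 0 1]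
  by simp

text \<open>Coordinate 0 of the path shifted by s is the pair at time s, and the law of the shifted
  path is the same for every s.\<close>

lemma stationary_expectation:
  fixes \<phi> :: "real \<times> real \<Rightarrow> real"
  assumes [measurable]: "\<phi> \<in> borel_measurable (borel \<Otimes>\<^sub>M borel)"
  shows "(\<integral>\<omega>. \<phi> (X s \<omega>, Y s \<omega>) \<partial>M) = (\<integral>\<omega>. \<phi> (X t \<omega>, Y t \<omega>) \<partial>M)"
proof -
  let ?P = "\<Pi>\<^sub>M t\<in>(UNIV :: int set). (borel :: real measure) \<Otimes>\<^sub>M (borel :: real measure)"
  note [measurable] = X_rv Y_rv
  have m: "(\<lambda>\<omega> t. (X (t + s) \<omega>, Y (t + s) \<omega>)) \<in> measurable M ?P" for s
    by (rule measurable_PiM_single') (auto simp: space_pair_measure)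
  have f: "(\<lambda>p. \<phi> (p 0)) \<in> borel_measurable ?P" by measurable
  have "(\<integral>\<omega>. \<phi> (X s \<omega>, Y s \<omega>) \<partial>M)
      = (\<integral>p. \<phi> (p 0) \<partial>distr M ?P (\<lambda>\<omega> t. (X (t + s) \<omega>, Y (t + s) \<omega>)))" for s
    by (subst integral_distr[OF m f]) simp
  then show ?thesis by (simp add: stationary)
qed

lemma expectation_abs_X: "(\<integral>\<omega>. \<bar>X s \<omega>\<bar> \<partial>M) = (\<integral>\<omega>. \<bar>X t \<omega>\<bar> \<partial>M)"
  using stationary_expectation[of "\<lambda>p. \<bar>fst p\<bar>" s t] by simp

lemma expectation_abs_Y: "(\<integral>\<omega>. \<bar>Y s \<omega>\<bar> \<partial>M) = (\<integral>\<omega>. \<bar>Y t \<omega>\<bar> \<partial>M)"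
  using stationary_expectation[of "\<lambda>p. \<bar>snd p\<bar>" s t] by simp

lemma integrable_E_Y: "integrable M (E_Y t)"
  by (rule normal_distributed_integrable[OF E_Y_normal]) simp

text \<open>The locale states stationarity for X and Y only; for the noise, a moment bound uniform
  in time comes from the common standard normal law.\<close>

lemma expectation_abs_E_Y: "(\<integral>\<omega>. \<bar>E_Y s \<omega>\<bar> \<partial>M) = (\<integral>x. std_normal_density x * \<bar>x\<bar> \<partial>lborel)"
  using distributed_integral[OF E_Y_normal[of s], of "\<lambda>x. \<bar>x\<bar>"] by simp

text \<open>A first absolute moment that is constant in time serves as its own uniform bound
  \<open>K\<close>. For X the time index stays free, so the bounds involve the moment at any chosen
  time.\<close>

lemmas time_avg_X = time_avg_bound[OF sigma_finite_measure_axioms integrable_X eq_refl[OF expectation_abs_X]]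
  and time_avg_Y = time_avg_bound[OF sigma_finite_measure_axioms integrable_Y eq_refl[OF expectation_abs_Y]]
  and time_avg_E_Y = time_avg_bound[OF sigma_finite_measure_axioms integrable_E_Y eq_refl[OF expectation_abs_E_Y]]
  and X_diff = AE_time_avg_diff[OF integrable_X eq_refl[OF expectation_abs_X]]
  and Y_diff = AE_time_avg_diff[OF integrable_Y eq_refl[OF expectation_abs_Y]]

lemma X_resolvent:
  assumes "\<bar>\<alpha>\<bar> < 1" "g \<in> ell1"
  shows "AE \<omega> in M. time_avg X g \<omega> = time_avg E_X (resolvent \<alpha> g) \<omega>"
proof -
  let ?h = "resolvent \<alpha> g"
  have h: "?h \<in> ell1" using assms by (simp add: resolvent_ell1)
  \<comment> \<open>By linearity this makes the time average of X against \<open>g\<close> the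
    difference of those against \<open>?h\<close> and \<open>scale \<alpha> (shift ?h)\<close>,
    which \<open>structural_X\<close> at \<open>?h\<close> identifies with noise.\<close>
  have "(\<lambda>t. ?h t - scale \<alpha> (shift ?h) t) = g"
    using id_minus_shift_resolvent[OF assms(2), of \<alpha>] assms(1) by (simp add: id_minus_shift_def scale_def)
  with X_diff[OF h ell1_scale[OF ell1_shift[OF h], of \<alpha>]]
  have "AE \<omega> in M. time_avg X g \<omega> = time_avg X ?h \<omega> - time_avg X (scale \<alpha> (shift ?h)) \<omega>" by simp
  with structural_X[OF h] show ?thesis by eventually_elim simp
qed

text \<open>The argument of \<open>X_resolvent\<close> with \<beta> leaves the influence of X as an
  extra term; for \<open>g_freq \<nu> T\<close> its weight is
  \<open>f_freq \<beta> \<gamma> \<nu> T\<close>.\<close>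

lemma Y_resolvent:
  assumes "\<bar>\<beta>\<bar> < 1" "g \<in> ell1"
  shows "AE \<omega> in M. time_avg Y g \<omega>
    = time_avg X (scale \<gamma> (shift (resolvent \<beta> g))) \<omega> + time_avg E_Y (resolvent \<beta> g) \<omega>"
proof -
  let ?h = "resolvent \<beta> g"
  have h: "?h \<in> ell1" using assms by (simp add: resolvent_ell1)
  have "(\<lambda>t. ?h t - scale \<beta> (shift ?h) t) = g"
    using id_minus_shift_resolvent[OF assms(2), of \<beta>] assms(1) by (simp add: id_minus_shift_def scale_def)
  with Y_diff[OF h ell1_scale[OF ell1_shift[OF h], of \<beta>]]
  have "AE \<omega> in M. time_avg Y g \<omega> = time_avg Y ?h \<omega> - time_avg Y (scale \<beta> (shift ?h)) \<omega>" by simp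
  with structural_Y[OF h] show ?thesis by eventually_elim simp
qed

text \<open>By \<open>Y_resolvent\<close> the noise cancels in \<open>err g\<close>, leaving a time
  average of X, to which the L1 bound applies. The frequency plays no part yet: \<open>g\<close> and
  \<open>c\<close> are arbitrary.\<close>

lemma Y_error:
  fixes c :: complex
  defines "err \<equiv> \<lambda>g \<omega>. time_avg Y g \<omega> - (c * time_avg X g \<omega> + time_avg E_Y (resolvent \<beta> g) \<omega>)"
  assumes b: "\<bar>\<beta>\<bar> < 1" and g: "g \<in> ell1"
  shows "integrable M (err g)"
    and "(\<integral>\<omega>. norm (err g \<omega>) \<partial>M) \<le> (\<integral>\<omega>. \<bar>X t \<omega>\<bar> \<partial>M)
      * ell1_norm (\<lambda>t. scale \<gamma> (shift (resolvent \<beta> g)) t - c * g t)"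
proof -
  let ?h = "resolvent \<beta> g"
  let ?f = "scale \<gamma> (shift ?h)"
  let ?d = "\<lambda>t. ?f t - c * g t"
  have h: "?h \<in> ell1" using b g by (simp add: resolvent_ell1)
  then have f: "?f \<in> ell1" by (intro ell1_scale ell1_shift)
  have d: "?d \<in> ell1" using ell1_diff[OF f ell1_scale[OF g, of c]] by (simp add: scale_def)
  show i: "integrable M (err g)" unfolding err_def
    by (intro Bochner_Integration.integrable_diff Bochner_Integration.integrable_add
        integrable_mult_right time_avg_X(2) time_avg_Y(2) time_avg_E_Y(2) g h)
  have "AE \<omega> in M. time_avg X ?d \<omega> = time_avg X ?f \<omega> - c * time_avg X g \<omega>"
    using X_diff[OF f ell1_scale[OF g, of c]] by (simp add: time_avg_scale) (simp add: scale_def)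
  with Y_resolvent[OF b g] have "AE \<omega> in M. err g \<omega> = time_avg X ?d \<omega>"
    by eventually_elim (simp add: err_def)
  then have "(\<integral>\<omega>. norm (err g \<omega>) \<partial>M) = (\<integral>\<omega>. norm (time_avg X ?d \<omega>) \<partial>M)"
    using i time_avg_X(2)[OF d] by (intro integral_cong_AE) auto
  also have "\<dots> \<le> (\<integral>\<omega>. \<bar>X t \<omega>\<bar> \<partial>M) * ell1_norm ?d"
    by (rule time_avg_X(3)[OF d])
  finally show "(\<integral>\<omega>. norm (err g \<omega>) \<partial>M) \<le> (\<integral>\<omega>. \<bar>X t \<omega>\<bar> \<partial>M) * ell1_norm ?d" .
qed

end

text \<open>The constant contains \<open>\<bar>\<beta>\<bar>\<close> because
  \<open>1 - \<beta> * z_freq \<nu>\<close> attains modulus \<open>1 - \<bar>\<beta>\<bar>\<close>,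
  at z = 1 or z = -1 according to the sign of \<beta>. The noise built from
  \<open>resolvent \<alpha> f\<close> represents X against \<open>f\<close>, not against
  \<open>g\<close>, so each has its own equation.\<close>

theorem mainTheorem2:
  fixes M :: "'w measure" and \<alpha> \<beta> \<gamma> :: real and X Y E_X E_Y :: "int \<Rightarrow> 'w \<Rightarrow> real"
  assumes "\<bar>\<alpha>\<bar> < 1" and "\<bar>\<beta>\<bar> < 1" and "\<beta> \<noteq> 0"
    and "stationary_AR M \<alpha> \<beta> \<gamma> X Y E_X E_Y"
  shows "\<forall>\<nu>.
    (\<forall>T. let
        g = g_freq \<nu> T;
        f = f_freq \<beta> \<gamma> \<nu> T;
        c = \<gamma> * z_freq \<nu> * inverse (1 - \<beta> * z_freq \<nu>);
        C = 2 / sqrt (2 * real T + 1) * (\<bar>\<gamma>\<bar> / \<bar>\<beta>\<bar>) * inverse ((1 - \<bar>\<beta>\<bar>)\<^sup>2);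
        d = (\<lambda>t. f t - c * g t);
        err = (\<lambda>\<omega>. time_avg Y g \<omega> - (c * time_avg X g \<omega> + time_avg E_Y (resolvent \<beta> g) \<omega>))
      in d \<in> ell1 \<and> ell1_norm d \<le> C
        \<and> (AE \<omega> in M. time_avg X g \<omega> = time_avg E_X (resolvent \<alpha> g) \<omega>)
        \<and> (AE \<omega> in M. time_avg X f \<omega> = time_avg E_X (resolvent \<alpha> f) \<omega>)
        \<and> integrable M err
        \<and> (\<forall>t. (\<integral>\<omega>. norm (err \<omega>) \<partial>M) \<le> C * (\<integral>\<omega>. \<bar>X t \<omega>\<bar> \<partial>M)))
    \<and> (\<lambda>T. ell1_norm (\<lambda>t. f_freq \<beta> \<gamma> \<nu> T t
          - \<gamma> * z_freq \<nu> * inverse (1 - \<beta> * z_freq \<nu>) * g_freq \<nu> T t))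
        \<in> O(\<lambda>T. 1 / sqrt (real T))"
proof (intro allI conjI)
  fix \<nu>
  interpret stationary_AR M \<alpha> \<beta> \<gamma> X Y E_X E_Y by fact
  let ?c = "\<gamma> * z_freq \<nu> * inverse (1 - \<beta> * z_freq \<nu>)"
  let ?d = "\<lambda>T t. f_freq \<beta> \<gamma> \<nu> T t - ?c * g_freq \<nu> T t"
  let ?C = "\<lambda>T. 2 / sqrt (2 * real T + 1) * (\<bar>\<gamma>\<bar> / \<bar>\<beta>\<bar>) * inverse ((1 - \<bar>\<beta>\<bar>)\<^sup>2)"
  have C: "ell1_norm (?d T) \<le> ?C T" for T
  proof -
    \<comment> \<open>Dividing by \<open>\<bar>\<beta>\<bar> < 1\<close> only enlarges the constant;
      \<open>\<beta> \<noteq> 0\<close> excludes the default value 0 of the quotient.\<close>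
    have "\<bar>\<gamma>\<bar> \<le> \<bar>\<gamma>\<bar> / \<bar>\<beta>\<bar>"
      using assms(2,3) by (simp add: le_divide_eq mult_left_le)
    then have "2 / sqrt (2 * real T + 1) * \<bar>\<gamma>\<bar> * inverse ((1 - \<bar>\<beta>\<bar>)\<^sup>2) \<le> ?C T"
      by (intro mult_left_mono mult_right_mono) auto
    with f_freq_approx(2)[OF assms(2)] show ?thesis by (rule order_trans)
  qed
  show "let g = g_freq \<nu> T; f = f_freq \<beta> \<gamma> \<nu> T; c = ?c; C = ?C T; d = (\<lambda>t. f t - c * g t);
        err = (\<lambda>\<omega>. time_avg Y g \<omega> - (c * time_avg X g \<omega> + time_avg E_Y (resolvent \<beta> g) \<omega>))
      in d \<in> ell1 \<and> ell1_norm d \<le> C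
        \<and> (AE \<omega> in M. time_avg X g \<omega> = time_avg E_X (resolvent \<alpha> g) \<omega>)
        \<and> (AE \<omega> in M. time_avg X f \<omega> = time_avg E_X (resolvent \<alpha> f) \<omega>)
        \<and> integrable M err
        \<and> (\<forall>t. (\<integral>\<omega>. norm (err \<omega>) \<partial>M) \<le> C * (\<integral>\<omega>. \<bar>X t \<omega>\<bar> \<partial>M))" for T
    unfolding Let_def
  proof (intro conjI allI)
    let ?g = "g_freq \<nu> T"
    let ?err = "\<lambda>\<omega>. time_avg Y ?g \<omega> - (?c * time_avg X ?g \<omega> + time_avg E_Y (resolvent \<beta> ?g) \<omega>)"
    fix t
    have "(\<integral>\<omega>. norm (?err \<omega>) \<partial>M) \<le> (\<integral>\<omega>. \<bar>X t \<omega>\<bar> \<partial>M) * ell1_norm (?d T)"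
      using Y_error(2)[OF assms(2) g_freq_ell1, of \<nu> T ?c t] by (simp add: f_freq_def)
    also have "\<dots> \<le> (\<integral>\<omega>. \<bar>X t \<omega>\<bar> \<partial>M) * ?C T"
      by (rule mult_left_mono[OF C]) simp
    finally show "(\<integral>\<omega>. norm (?err \<omega>) \<partial>M) \<le> ?C T * (\<integral>\<omega>. \<bar>X t \<omega>\<bar> \<partial>M)"
      by (simp only: mult.commute)
  qed (intro f_freq_approx(1) C X_resolvent Y_error(1) g_freq_ell1 f_freq_ell1 assms)+
  show "(\<lambda>T. ell1_norm (?d T)) \<in> O(\<lambda>T. 1 / sqrt (real T))"
  \<comment> \<open>At T = 0 the comparison function is 1 / 0 = 0, so only positive T are
    considered; there sqrt (2 T + 1) is at least sqrt T.\<close>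
  proof (rule bigoI[OF eventually_mono[OF eventually_gt_at_top[of 0]]])
    fix T :: nat assume "0 < T"
    then have "?C T \<le> 2 / sqrt (real T) * (\<bar>\<gamma>\<bar> / \<bar>\<beta>\<bar>) * inverse ((1 - \<bar>\<beta>\<bar>)\<^sup>2)"
      by (intro mult_right_mono divide_left_mono) auto
    with C[of T] show "norm (ell1_norm (?d T))
        \<le> 2 * (\<bar>\<gamma>\<bar> / \<bar>\<beta>\<bar>) * inverse ((1 - \<bar>\<beta>\<bar>)\<^sup>2) * norm (1 / sqrt (real T))"
      by (simp add: ell1_norm_def infsum_nonneg mult.commute)
  qed
qed

end
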